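(* For each integer $n\ge 0$ let $\mathscr{T}_n(x)=\sum_{k=0}^{\lfloor n/2\rfloor}T(n,k)x^k$, where $T(n,k)=\frac{n!}{k!\,k!\,(n-2k)!}$. Then every polynomial $\mathscr{T}_n(x)$, $n\ge 0$, is real-rooted. Furthermore, $\mathscr{T}_{n-1}(x)\prec \mathscr{T}_{n+1}(x)$ for all $n\ge 1$, and $\mathscr{T}_n(x)\prec \mathscr{T}_{n+1}(x)$ for all $n\ge 0$, where $\prec$ denotes strict interlacing.
   Context: A real polynomial is real-rooted if all its roots are real. For a real-rooted polynomial $f$, let $r_1(f)\ge r_2(f)\ge\cdots$ be its roots (with multiplicity) in non-increasing order. For real-rooted polynomials $f,g$ with $\deg g\le \deg f\le \deg g+1$, we say that $g$ strictly interlaces $f$, written $g\prec f$, if $r_1(f)>r_1(g)>r_2(f)>r_2(g)>\cdots$ (the chain running through all the roots of $f$ and $g$). By convention, a real constant $a$ is real-rooted, and $a\prec bx+c$ whenever $a>0$, $b+c>0$, $b\ge 0$ and $c\ge 0$ (so in particular $1\prec 1$). *)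

theory Defs
  imports "HOL-Computational_Algebra.Computational_Algebra"
begin

(* The first disjunct is the convention that every constant, including 0, is real-rooted. *)
definition real_rooted :: "real poly \<Rightarrow> bool" where
  "real_rooted p \<longleftrightarrow>
     degree p = 0 \<or> (\<forall>z::complex. poly (map_poly complex_of_real p) z = 0 \<longrightarrow> z \<in> \<real>)"

definition root_list :: "real poly \<Rightarrow> real list" where
  "root_list p = rev (sorted_list_of_multiset (proots p))"

(* strictly_interlaces g f is read g \<prec> f. As degree g \<le> degree f \<le> degree g + 1,
   splicing the root lists of f and g gives r_1(f), r_1(g), r_2(f), r_2(g), ... with no
   leftover tail. A constant g has no roots to interlace, so that case is governed solely
   by the convention a \<prec> bx + c. *)
definition strictly_interlaces :: "real poly \<Rightarrow> real poly \<Rightarrow> bool" (infix "\<prec>" 50) where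
  "g \<prec> f \<longleftrightarrow>
     real_rooted f \<and> real_rooted g \<and> degree g \<le> degree f \<and> degree f \<le> degree g + 1 \<and>
     (if degree g = 0
      then \<exists>a b c. g = [:a:] \<and> f = [:c, b:] \<and> a > 0 \<and> b + c > 0 \<and> b \<ge> 0 \<and> c \<ge> 0
      else sorted_wrt (>) (splice (root_list f) (root_list g)))"

definition T :: "nat \<Rightarrow> nat \<Rightarrow> real" where
  "T n k = fact n / (fact k * fact k * fact (n - 2 * k))"

definition T_poly :: "nat \<Rightarrow> real poly" where
  "T_poly n = (\<Sum>k = 0..n div 2. monom (T n k) k)"

end

theory Submission
  imports Defs
begin

text \<open>The polynomials satisfy
  \<open>(n + 2) T\<^sub>n\<^sub>+\<^sub>2 = (2n + 3) T\<^sub>n\<^sub>+\<^sub>1 - (n + 1) (1 - 4x) T\<^sub>n\<close>, where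
  \<open>1 - 4x > 0\<close> on the negative axis. If \<open>T\<^sub>n\<close> alternates in sign at the
  roots of \<open>T\<^sub>n\<^sub>+\<^sub>1\<close>, then \<open>T\<^sub>n\<^sub>+\<^sub>2\<close> alternates there with the opposite signs;
  with its value 1 at 0 and its sign at \<open>- \<infinity>\<close>, the intermediate value theorem
  yields all its roots, interlaced with those of \<open>T\<^sub>n\<^sub>+\<^sub>1\<close>. At these roots
  \<open>T\<^sub>n\<close> and \<open>T\<^sub>n\<^sub>+\<^sub>1\<close> have the same sign, which closes the induction and also
  shows that \<open>T\<^sub>n\<close> interlaces \<open>T\<^sub>n\<^sub>+\<^sub>2\<close>.\<close>

section \<open>Polynomials with as many distinct roots as their degree\<close>

text \<open>With equal leading terms, the difference of the two sides has too small a degree to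
  vanish at \<open>degree p\<close> distinct points, unless it is zero.\<close>

lemma poly_eq_smult_prod_roots:
  fixes p :: "'a::idom poly"
  assumes inj: "inj_on r {..<degree p}"
    and root: "\<And>i. i < degree p \<Longrightarrow> poly p (r i) = 0"
  shows "p = smult (lead_coeff p) (\<Prod>i<degree p. [:- r i, 1:])" (is "p = smult _ ?q")
proof (rule poly_eqI_degree_lead_coeff)
  have "lead_coeff ?q = 1"
    by (simp add: lead_coeff_prod)
  moreover have deg: "degree ?q = degree p"
    by (simp add: degree_prod_eq_sum_degree)
  ultimately show "coeff p (degree p) = coeff (smult (lead_coeff p) ?q) (degree p)"
    by simp
  show "degree (smult (lead_coeff p) ?q) \<le> degree p"
    using degree_smult_le deg by metis
  show "degree p \<le> card (r ` {..<degree p})"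
    by (simp add: card_image inj)
  show "poly p z = poly (smult (lead_coeff p) ?q) z" if "z \<in> r ` {..<degree p}" for z
    using that root by (auto simp: poly_prod)
qed auto

text \<open>The given real roots already exhaust the bound \<open>degree p\<close> on the number of
  complex roots.\<close>

lemma real_rooted_if_roots:
  assumes inj: "inj_on r {..<degree p}"
    and root: "\<And>i. i < degree p \<Longrightarrow> poly p (r i) = 0"
  shows "real_rooted p"
proof (cases "p = 0")
  case False
  define q where "q = map_poly complex_of_real p"
  have degq: "degree q = degree p"
    unfolding q_def by (simp add: degree_map_poly)
  have "q \<noteq> 0"
    using False by (simp add: q_def map_poly_eq_0_iff)
  let ?R = "(\<lambda>i. complex_of_real (r i)) ` {..<degree p}"
  have "poly q (of_real x) = of_real (poly p x)" for x
    unfolding q_def by (induction p) (simp_all add: map_poly_pCons)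
  then have "?R \<subseteq> {z. poly q z = 0}"
    using root by auto
  moreover have "card ?R = degree p"
    using inj by (subst card_image) (auto simp: inj_on_def)
  ultimately have roots: "{z. poly q z = 0} = ?R"
    using card_poly_roots_bound[OF \<open>q \<noteq> 0\<close>] degq poly_roots_finite[OF \<open>q \<noteq> 0\<close>]
    by (intro card_seteq[symmetric]) auto
  have "z \<in> \<real>" if "poly q z = 0" for z
  proof -
    have "z \<in> ?R"
      using that roots by blast
    then show ?thesis by auto
  qed
  then show ?thesis
    by (simp add: real_rooted_def q_def)
qed (simp add: real_rooted_def)

lemma proots_eq_mset_roots:
  fixes p :: "real poly"
  assumes "p \<noteq> 0" "inj_on r {..<degree p}" "\<And>i. i < degree p \<Longrightarrow> poly p (r i) = 0"
  shows "proots p = mset (map r [0..<degree p])"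
proof -
  have "proots p = proots (smult (lead_coeff p) (\<Prod>i<degree p. [:- r i, 1:]))"
    using poly_eq_smult_prod_roots[of r p] assms by simp
  also have "\<dots> = (\<Sum>i<degree p. {#r i#})"
    using assms(1) by (simp add: proots_prod del: mset_map)
  also have "\<dots> = mset (map r [0..<degree p])"
    by (simp add: atLeast0LessThan sum_unfold_sum_mset)
  finally show ?thesis .
qed

lemma seq_less_if_Suc_less:
  fixes r :: "nat \<Rightarrow> 'a::order"
  assumes dec: "\<And>i. Suc i < d \<Longrightarrow> r (Suc i) < r i" and "i < j" "j < d"
  shows "r j < r i"
  using \<open>i < j\<close> \<open>j < d\<close>
proof (induction j rule: less_induct)
  case (less j)
  then obtain k where k: "j = Suc k" by (cases j) auto
  show ?case
  proof (cases "i = k")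
    case True
    then show ?thesis using dec less k by simp
  next
    case False
    then have "r k < r i" using less k by simp
    moreover have "r j < r k" using dec less k by simp
    ultimately show ?thesis by order
  qed
qed

lemma inj_on_if_Suc_less:
  fixes r :: "nat \<Rightarrow> 'a::order"
  assumes "\<And>i. Suc i < d \<Longrightarrow> r (Suc i) < r i"
  shows "inj_on r {..<d}"
proof (rule linorder_inj_onI)
  show "r i \<noteq> r j" if "i < j" "i \<in> {..<d}" "j \<in> {..<d}" for i j
    using seq_less_if_Suc_less[of d r i j, OF assms] that by simp
qed auto

lemma root_list_eq_map:
  assumes "p \<noteq> 0" and dec: "\<And>i. Suc i < degree p \<Longrightarrow> r (Suc i) < r i"
    and "\<And>i. i < degree p \<Longrightarrow> poly p (r i) = 0"
  shows "root_list p = map r [0..<degree p]"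
proof -
  have "sorted_wrt (>) (map r [0..<degree p])"
    using dec by (simp add: sorted_wrt_iff_nth_Suc_transp)
  then have "sorted_wrt (\<ge>) (map r [0..<degree p])"
    by (rule sorted_wrt_mono_rel[rotated]) simp
  then have "sorted (rev (map r [0..<degree p]))"
    by (subst sorted_wrt_rev)
  then have "sort (map r [0..<degree p]) = rev (map r [0..<degree p])"
    by (intro properties_for_sort) simp_all
  then show ?thesis
    using proots_eq_mset_roots[OF assms(1) inj_on_if_Suc_less[of "degree p" r] assms(3)] dec
    unfolding root_list_def by (simp del: mset_map)
qed

section \<open>Interlacing from root sequences\<close>

text \<open>The induction follows \<open>splice\<close>: removing the head \<open>t 0\<close> swaps
  the two lists, and the bounds on \<open>d\<close> and \<open>e\<close> are such that they survive
  the swap.\<close>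

lemma successively_splice_map_upt:
  fixes t s :: "nat \<Rightarrow> 'a"
  assumes "e \<le> d" "d \<le> Suc e"
    and "\<And>i. i < e \<Longrightarrow> P (t i) (s i)"
    and "\<And>i. Suc i < d \<Longrightarrow> P (s i) (t (Suc i))"
  shows "successively P (splice (map t [0..<d]) (map s [0..<e]))"
  using assms
proof (induction "d + e" arbitrary: d e t s rule: less_induct)
  case less
  show ?case
  proof (cases d)
    case (Suc d')
    let ?t = "\<lambda>i. t (Suc i)"
    have map_t: "map t [0..<d] = t 0 # map ?t [0..<d']"
      by (simp only: Suc map_upt_Suc)
    have IH: "successively P (splice (map s [0..<e]) (map ?t [0..<d']))"
      using less(1)[of e d' s ?t] less(2-5) Suc by simp
    show ?thesis
    proof (cases e)
      case 0
      then show ?thesis using less(3) Suc by simp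
    next
      case (Suc e')
      have "map s [0..<e] = s 0 # map (\<lambda>i. s (Suc i)) [0..<e']"
        by (simp only: Suc map_upt_Suc)
      then show ?thesis
        using IH less(4)[of 0] Suc by (simp add: map_t)
    qed
  qed (use less(2) in simp)
qed

text \<open>The inequalities chain into t 0 > s 0 > t 1 > ..., so both sequences decrease and are
  the full root lists. With \<open>degree g > 0\<close> the convention for constants does not
  apply.\<close>

lemma strictly_interlacesI:
  assumes "degree g > 0" "degree g \<le> degree f" "degree f \<le> Suc (degree g)"
    and f: "\<And>i. i < degree f \<Longrightarrow> poly f (t i) = 0"
    and g: "\<And>i. i < degree g \<Longrightarrow> poly g (s i) = 0"
    and ts: "\<And>i. i < degree g \<Longrightarrow> s i < t i"
    and st: "\<And>i. Suc i < degree f \<Longrightarrow> t (Suc i) < s i"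
  shows "g \<prec> f"
proof -
  have t: "t (Suc i) < t i" if "Suc i < degree f" for i
    using ts[of i] st[of i] that assms(3) by simp
  have s: "s (Suc i) < s i" if "Suc i < degree g" for i
    using ts[of "Suc i"] st[of i] that assms(2) by simp
  have "g \<noteq> 0" "f \<noteq> 0"
    using assms by auto
  then have "root_list f = map t [0..<degree f]" "root_list g = map s [0..<degree g]"
    using root_list_eq_map[of f t, OF _ t f] root_list_eq_map[of g s, OF _ s g] by auto
  moreover have "successively (>) (splice (map t [0..<degree f]) (map s [0..<degree g]))"
    using assms by (intro successively_splice_map_upt) auto
  moreover have "real_rooted f" "real_rooted g"
    using real_rooted_if_roots[of t f, OF inj_on_if_Suc_less[of "degree f" t, OF t] f]
      real_rooted_if_roots[of s g, OF inj_on_if_Suc_less[of "degree g" s, OF s] g] by auto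
  ultimately show ?thesis
    using assms(1-3) by (simp add: strictly_interlaces_def successively_conv_sorted_wrt)
qed

section \<open>Signs and roots of real polynomials\<close>

lemma alternating_signs_imp_roots:
  fixes p :: "real poly"
  assumes sgn: "\<And>i. i \<le> d \<Longrightarrow> (-1) ^ i * poly p (u i) > 0"
    and dec: "\<And>i. i < d \<Longrightarrow> u (Suc i) < u i"
  obtains t where "\<And>i. i < d \<Longrightarrow> poly p (t i) = 0"
    and "\<And>i. i < d \<Longrightarrow> t i < u i" and "\<And>i. i < d \<Longrightarrow> u (Suc i) < t i"
proof -
  have "\<exists>x. u (Suc i) < x \<and> x < u i \<and> poly p x = 0" if "i < d" for i
  proof -
    have "poly p (u (Suc i)) * poly p (u i) < 0"
      using sgn[of i] sgn[of "Suc i"] that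
      by (cases "even i") (auto simp: mult_less_0_iff)
    then show ?thesis
      using poly_IVT[OF dec[OF that]] by blast
  qed
  then show ?thesis
    using that by metis
qed

text \<open>Reflecting the argument and correcting the sign restores a positive leading coefficient,
  which reduces the claim to plus infinity.\<close>

lemma sign_at_minus_infinity:
  fixes p :: "real poly"
  assumes "lead_coeff p > 0"
  obtains x where "x < B" "(-1) ^ degree p * poly p x > 0"
proof -
  let ?q = "smult ((-1) ^ degree p) (p \<circ>\<^sub>p [:0, -1:])"
  have deg: "degree ?q = degree p"
    by (simp add: degree_pcompose)
  have "lead_coeff (p \<circ>\<^sub>p [:0, -1:]) = lead_coeff p * (-1) ^ degree p"
    by (subst lead_coeff_comp) auto
  then have "lead_coeff ?q = lead_coeff p"
    by (simp add: lead_coeff_smult flip: power_mult_distrib)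
  then obtain N where "\<And>x. x \<ge> N \<Longrightarrow> poly ?q x > 0"
    using poly_pinfty_gt_lc[of ?q] assms by force
  \<comment> \<open>The term \<open>1 - B\<close> puts the reflected point at or below
    \<open>B - 1\<close>, hence strictly below \<open>B\<close>.\<close>
  then have "poly ?q (max N (1 - B)) > 0"
    by simp
  then show ?thesis
    by (intro that[of "- max N (1 - B)"]) (auto simp: poly_pcompose)
qed

text \<open>In the factorisation of \<open>p\<close>, exactly the \<open>k\<close> roots above
  \<open>x\<close> contribute negative factors.\<close>

lemma sign_poly_between_roots:
  fixes p :: "real poly"
  assumes "inj_on r {..<degree p}" "\<And>i. i < degree p \<Longrightarrow> poly p (r i) = 0"
    and "lead_coeff p > 0" "k \<le> degree p"
    and left: "\<And>i. i < k \<Longrightarrow> x < r i" and right: "\<And>i. k \<le> i \<Longrightarrow> i < degree p \<Longrightarrow> r i < x"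
  shows "(-1) ^ k * poly p x > 0"
proof -
  let ?d = "degree p"
  have "poly p x = lead_coeff p * (\<Prod>i<?d. x - r i)"
    by (subst poly_eq_smult_prod_roots[OF assms(1,2)]) (simp_all add: poly_prod)
  also have "{..<?d} = {..<k} \<union> {k..<?d}"
    using assms(4) by auto
  also have "(\<Prod>i\<in>{..<k} \<union> {k..<?d}. x - r i) = (\<Prod>i<k. x - r i) * (\<Prod>i=k..<?d. x - r i)"
    by (rule prod.union_disjoint) auto
  finally have "(-1) ^ k * poly p x
      = lead_coeff p * ((-1) ^ k * (\<Prod>i<k. x - r i)) * (\<Prod>i=k..<?d. x - r i)"
    by simp
  also have "(-1) ^ k * (\<Prod>i<k. x - r i) = (\<Prod>i<k. r i - x)"
    using prod.distrib[of "\<lambda>_. -1" "\<lambda>i. x - r i" "{..<k}"] by simp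
  finally show ?thesis
    using assms(3) left right by (auto intro!: mult_pos_pos prod_pos)
qed

section \<open>Coefficients and the three-term recurrence\<close>

lemma T_pos: "T n k > 0"
  by (simp add: T_def)

lemma coeff_T_poly: "coeff (T_poly n) k = (if 2 * k \<le> n then T n k else 0)"
proof -
  have "coeff (T_poly n) k = (\<Sum>j = 0..n div 2. if j = k then T n j else 0)"
    by (simp add: T_poly_def coeff_sum)
  then show ?thesis
    by (auto simp: sum.delta)
qed

lemma degree_T_poly: "degree (T_poly n) = n div 2"
proof (rule antisym)
  show "degree (T_poly n) \<le> n div 2"
    by (rule degree_le) (auto simp: coeff_T_poly)
  show "n div 2 \<le> degree (T_poly n)"
    using T_pos[of n "n div 2"] by (intro le_degree) (simp add: coeff_T_poly)
qed

lemma lead_coeff_T_poly_pos: "lead_coeff (T_poly n) > 0"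
  by (simp add: degree_T_poly coeff_T_poly T_pos)

lemma poly_T_poly_0: "poly (T_poly n) 0 = 1"
  by (simp add: poly_0_coeff_0 coeff_T_poly T_def)

lemma T_recurrence_Suc:
  assumes "2 * Suc j \<le> n"
  shows "(real n + 2) * T (n + 2) (Suc j) =
    (2 * real n + 3) * T (n + 1) (Suc j) - (real n + 1) * T n (Suc j) + 4 * (real n + 1) * T n j"
proof -
  \<comment> \<open>In terms of \<open>m\<close>, the truncated subtractions in the factorials
    become plain sums.\<close>
  obtain m where n: "n = 2 * j + 2 + m"
    using assms by (auto simp: le_iff_add)
  have "n + 2 - 2 * Suc j = m + 2" "n + 1 - 2 * Suc j = m + 1" "n - 2 * Suc j = m"
      "n - 2 * j = m + 2"
    using n by auto
  then show ?thesis
    unfolding T_def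
    by (simp add: divide_simps) (simp add: n algebra_simps power2_eq_square)
qed

text \<open>This is the Legendre recurrence, as \<open>T_poly n\<close> at \<open>x\<close> equals
  \<open>(1 - 4 * x) powr (n / 2)\<close> times the Legendre polynomial of degree \<open>n\<close>
  at \<open>1 / sqrt (1 - 4 * x)\<close>.\<close>

lemma T_poly_recurrence:
  "smult (real n + 2) (T_poly (n + 2)) =
    smult (2 * real n + 3) (T_poly (n + 1)) - smult (real n + 1) ([:1, -4:] * T_poly n)"
proof (rule poly_eqI)
  fix k
  show "coeff (smult (real n + 2) (T_poly (n + 2))) k =
    coeff (smult (2 * real n + 3) (T_poly (n + 1)) - smult (real n + 1) ([:1, -4:] * T_poly n)) k"
  proof (cases k)
    case 0
    then show ?thesis
      by (simp add: coeff_T_poly T_def)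
  next
    case (Suc j)
    \<comment> \<open>From case to case, first the \<open>k\<close>-th coefficient of
      \<open>T_poly n\<close> vanishes, then also that of \<open>T_poly (n + 1)\<close>, and finally
      every term.\<close>
    consider "2 * k \<le> n" | "n = 2 * j + 1" | "n = 2 * j" | "2 * k > n + 2"
      using Suc by linarith
    then show ?thesis
    proof cases
      case 1
      then show ?thesis
        using T_recurrence_Suc[of j n] by (simp add: Suc coeff_T_poly algebra_simps)
    next
      case 2
      then show ?thesis
        by (simp add: Suc coeff_T_poly T_def divide_simps) (simp add: algebra_simps)
    next
      case 3
      then show ?thesis
        by (simp add: Suc coeff_T_poly T_def divide_simps) (simp add: algebra_simps)
    next
      case 4
      then show ?thesis
        by (simp add: Suc coeff_T_poly)
    qed
  qed
qed

lemma poly_T_poly_recurrence: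
  "(real n + 2) * poly (T_poly (n + 2)) x =
    (2 * real n + 3) * poly (T_poly (n + 1)) x - (real n + 1) * (1 - 4 * x) * poly (T_poly n) x"
  using arg_cong[OF T_poly_recurrence, of "\<lambda>p. poly p x" n] by (simp add: algebra_simps)

section \<open>The induction on sign patterns\<close>

text \<open>Interlacing is encoded by signs of \<open>g\<close> because the recurrence, evaluated at
  a root of its middle polynomial, transfers signs directly.\<close>

definition alternates_at_roots :: "real poly \<Rightarrow> real poly \<Rightarrow> (nat \<Rightarrow> real) \<Rightarrow> bool" where
  "alternates_at_roots g f r \<longleftrightarrow>
    (\<forall>i < degree f. poly f (r i) = 0 \<and> r i < 0 \<and> (-1) ^ i * poly g (r i) > 0) \<and>
    (\<forall>i. Suc i < degree f \<longrightarrow> r (Suc i) < r i)"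

text \<open>Beyond the invariant, the positions of \<open>r\<close> and \<open>s\<close> serve the
  interlacing of neighbours, and the signs of \<open>T_poly n\<close> serve that of indices two
  apart.\<close>

lemma T_poly_step:
  assumes "alternates_at_roots (T_poly n) (T_poly (n + 1)) r"
  obtains s where "alternates_at_roots (T_poly (n + 1)) (T_poly (n + 2)) s"
    and "\<And>i. i < (n + 1) div 2 \<Longrightarrow> r i < s i"
    and "\<And>i. Suc i < (n + 2) div 2 \<Longrightarrow> s (Suc i) < r i"
    and "\<And>i. i < (n + 2) div 2 \<Longrightarrow> (-1) ^ i * poly (T_poly n) (s i) > 0"
proof -
  define d where "d = (n + 1) div 2"
  define e where "e = (n + 2) div 2"
  have de: "d \<le> e" "e \<le> Suc d"
    by (auto simp: d_def e_def)
  let ?g = "T_poly n" and ?f = "T_poly (n + 1)" and ?h = "T_poly (n + 2)"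
  have deg: "degree ?f = d" "degree ?h = e"
    unfolding d_def e_def by (simp_all only: degree_T_poly)
  have root: "poly ?f (r i) = 0" and neg: "r i < 0"
    and sgn: "(-1) ^ i * poly ?g (r i) > 0" if "i < d" for i
    using assms that deg by (auto simp: alternates_at_roots_def)
  have dec: "r (Suc i) < r i" if "Suc i < d" for i
    using assms that deg by (auto simp: alternates_at_roots_def)
  have h_sgn: "(-1) ^ Suc i * poly ?h (r i) > 0" if i: "i < d" for i
  proof -
    have "(real n + 2) * ((-1) ^ Suc i * poly ?h (r i)) =
        (-1) ^ Suc i * ((real n + 2) * poly ?h (r i))"
      by simp
    also have "\<dots> = (real n + 1) * (1 - 4 * r i) * ((-1) ^ i * poly ?g (r i))"
      unfolding poly_T_poly_recurrence using root[OF i] by simp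
    also have "\<dots> > 0"
      using neg[OF i] by (intro mult_pos_pos sgn i) auto
    finally show ?thesis
      by (rule zero_less_mult_pos) simp
  qed
  \<comment> \<open>\<open>M\<close> lies below the least root of \<open>?f\<close>, or below 0 if
    \<open>?f\<close> has no roots.\<close>
  obtain M where M: "M < (if d = 0 then 0 else r (d - 1))" "(-1) ^ e * poly ?h M > 0"
    using sign_at_minus_infinity[OF lead_coeff_T_poly_pos] deg(2) by metis
  \<comment> \<open>The \<open>e + 1\<close> test points are 0, the roots of \<open>?f\<close>, and
    \<open>M\<close> exactly when \<open>e = Suc d\<close>.\<close>
  define u where "u i = (if i = 0 then 0 else if i \<le> d then r (i - 1) else M)" for i
  have "(-1) ^ i * poly ?h (u i) > 0" if "i \<le> e" for i
  proof -
    consider "i = 0" | j where "i = Suc j" "j < d" | "i = Suc d"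
      using \<open>i \<le> e\<close> de by (cases i) force+
    then show ?thesis
    proof cases
      case 1
      then show ?thesis
        by (simp add: u_def poly_T_poly_0)
    next
      case 2
      then show ?thesis
        using h_sgn[of j] by (simp add: u_def)
    next
      case 3
      moreover have "e = Suc d"
        using 3 \<open>i \<le> e\<close> de by simp
      ultimately show ?thesis
        using M(2) by (simp add: u_def)
    qed
  qed
  moreover have "u (Suc i) < u i" if "i < e" for i
    using that M(1) de dec[of "i - 1"] neg[of 0]
    by (cases "i = d"; cases i) (auto simp: u_def)
  ultimately obtain s where s: "\<And>i. i < e \<Longrightarrow> poly ?h (s i) = 0"
    and su: "\<And>i. i < e \<Longrightarrow> s i < u i" and us: "\<And>i. i < e \<Longrightarrow> u (Suc i) < s i"
    using alternating_signs_imp_roots[of e ?h u] by metis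
  have rs: "r i < s i" if "i < d" for i
    using us[of i] that de by (simp add: u_def)
  have sr: "s (Suc i) < r i" if "Suc i < e" for i
    using su[of "Suc i"] that de by (simp add: u_def)
  have s_dec: "s (Suc i) < s i" if "Suc i < e" for i
    using rs[of i] sr[of i] that de by simp
  have s_neg: "s i < 0" if "i < e" for i
    using su[of 0] seq_less_if_Suc_less[of e s 0 i, OF s_dec] that
    by (cases "i = 0") (auto simp: u_def)
  \<comment> \<open>Exactly the \<open>i\<close> roots \<open>r 0\<close>, ...,
    \<open>r (i - 1)\<close> of \<open>?f\<close> lie above \<open>s i\<close>.\<close>
  have f_sgn: "(-1) ^ i * poly ?f (s i) > 0" if i: "i < e" for i
  proof (rule sign_poly_between_roots[of r])
    show "inj_on r {..<degree ?f}"
      unfolding deg using dec by (rule inj_on_if_Suc_less)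
    show "i \<le> degree ?f"
      using i de deg by simp
    show "s i < r j" if "j < i" for j
    proof -
      have "s i \<le> s (Suc j)"
        using seq_less_if_Suc_less[of e s "Suc j" i, OF s_dec] that i
        by (cases "Suc j = i") auto
      then show ?thesis
        using sr[of j] that i by simp
    qed
    show "r j < s i" if "i \<le> j" "j < degree ?f" for j
    proof -
      have "r j \<le> r i"
        using seq_less_if_Suc_less[of d r i j, OF dec] that deg by (cases "i = j") auto
      then show ?thesis
        using rs[of i] that deg by simp
    qed
  qed (use root deg lead_coeff_T_poly_pos in auto)
  have g_sgn: "(-1) ^ i * poly ?g (s i) > 0" if i: "i < e" for i
  proof -
    have "(real n + 1) * (1 - 4 * s i) * ((-1) ^ i * poly ?g (s i)) =
        (-1) ^ i * ((real n + 1) * (1 - 4 * s i) * poly ?g (s i))"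
      by simp
    also have "\<dots> = (2 * real n + 3) * ((-1) ^ i * poly ?f (s i))"
      using poly_T_poly_recurrence[of n "s i"] s[OF i] by simp
    also have "\<dots> > 0"
      using f_sgn[OF i] by simp
    finally show ?thesis
      by (rule zero_less_mult_pos) (use s_neg[OF i] in \<open>auto intro: mult_pos_pos\<close>)
  qed
  show ?thesis
  proof (rule that)
    show "alternates_at_roots ?f ?h s"
      using s s_neg f_sgn s_dec deg by (simp add: alternates_at_roots_def)
  qed (use rs sr g_sgn in \<open>simp_all add: d_def e_def\<close>)
qed

lemma T_poly_alternates: "\<exists>r. alternates_at_roots (T_poly n) (T_poly (n + 1)) r"
proof (induction n)
  case 0
  \<comment> \<open>\<open>T_poly 1\<close> is constant, so the condition is vacuous.\<close>
  then show ?case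
    using degree_T_poly[of 1] by (simp add: alternates_at_roots_def)
next
  case (Suc n)
  then show ?case
    using T_poly_step[of n] by (metis Suc_eq_plus1 add_2_eq_Suc')
qed

section \<open>Small cases and the interlacing relations\<close>

lemma T_poly_0: "T_poly 0 = [:1:]"
  and T_poly_1: "T_poly 1 = [:1:]"
  and T_poly_2: "T_poly 2 = [:1, 2:]"
  and T_poly_3: "T_poly 3 = [:1, 6:]"
  by (simp_all add: T_poly_def T_def monom_0 monom_altdef fact_numeral)

lemma real_rooted_linear: "real_rooted [:c, b:]"
  \<comment> \<open>For \<open>b = 0\<close> the degree is 0 and no root is asked for.\<close>
  by (rule real_rooted_if_roots[of "\<lambda>_. - c / b"]) (auto simp: inj_on_def split: if_splits)

lemma const_strictly_interlaces_linear:
  assumes "a > 0" "b + c > 0" "b \<ge> 0" "c \<ge> 0"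
  shows "[:a:] \<prec> [:c, b:]"
  using assms real_rooted_linear[of c b]
  by (auto simp: strictly_interlaces_def real_rooted_def)

lemma T_poly_strictly_interlaces:
  shows "T_poly (n + 1) \<prec> T_poly (n + 2)" and "T_poly n \<prec> T_poly (n + 2)"
proof -
  let ?g = "T_poly n" and ?f = "T_poly (n + 1)" and ?h = "T_poly (n + 2)"
  obtain r where r: "alternates_at_roots ?g ?f r"
    using T_poly_alternates by blast
  then obtain s where s: "alternates_at_roots ?f ?h s"
    and rs: "\<And>i. i < (n + 1) div 2 \<Longrightarrow> r i < s i"
    and sr: "\<And>i. Suc i < (n + 2) div 2 \<Longrightarrow> s (Suc i) < r i"
    and sgn: "\<And>i. i < (n + 2) div 2 \<Longrightarrow> (-1) ^ i * poly ?g (s i) > 0"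
    by (rule T_poly_step) blast
  have s_root: "poly ?h (s i) = 0" if "i < degree ?h" for i
    using s that by (simp add: alternates_at_roots_def)
  have s_dec: "s (Suc i) < s i" if "i < n div 2" for i
    using s that by (simp add: alternates_at_roots_def degree_T_poly)
  show "?f \<prec> ?h"
  proof (cases "n = 0")
    case True
    then show ?thesis
      using const_strictly_interlaces_linear[of 1 2 1] T_poly_1 T_poly_2
      by (simp add: numeral_2_eq_2)
  next
    case False
    then show ?thesis
      using r s_root rs sr
      by (intro strictly_interlacesI[of _ _ s r])
        (auto simp: alternates_at_roots_def degree_T_poly)
  qed
  show "?g \<prec> ?h"
  \<comment> \<open>For \<open>n < 2\<close> the polynomial \<open>?g\<close> is the constant 1, and
    the convention decides.\<close>
  proof (cases "n < 2")
    case True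
    then consider "n = 0" | "n = 1" by linarith
    then show ?thesis
      using const_strictly_interlaces_linear[of 1 2 1] const_strictly_interlaces_linear[of 1 6 1]
        T_poly_0 T_poly_1 T_poly_2 T_poly_3
      by cases (simp_all add: eval_nat_numeral)
  next
    case False
    \<comment> \<open>The \<open>n div 2 + 1\<close> roots of \<open>?h\<close> leave
      \<open>n div 2\<close> gaps; one root of \<open>?g\<close> in each matches its degree.\<close>
    obtain q where q: "\<And>i. i < n div 2 \<Longrightarrow> poly ?g (q i) = 0"
      and qs: "\<And>i. i < n div 2 \<Longrightarrow> q i < s i" and sq: "\<And>i. i < n div 2 \<Longrightarrow> s (Suc i) < q i"
      using alternating_signs_imp_roots[of "n div 2" ?g s] sgn s_dec by auto
    show ?thesis
      using False q qs sq s_root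
      by (intro strictly_interlacesI[of _ _ s q]) (auto simp: degree_T_poly)
  qed
qed

theorem theorem2p1:
  shows "(\<forall>n::nat. real_rooted (T_poly n)) \<and>
         (\<forall>n::nat. n \<ge> 1 \<longrightarrow> T_poly (n - 1) \<prec> T_poly (n + 1)) \<and>
         (\<forall>n::nat. T_poly n \<prec> T_poly (n + 1))"
proof (intro conjI allI impI)
  fix n :: nat
  show "T_poly (n - 1) \<prec> T_poly (n + 1)" if "n \<ge> 1"
    using T_poly_strictly_interlaces(2)[of "n - 1"] that by simp
  show "T_poly n \<prec> T_poly (n + 1)"
  proof (cases n)
    case 0
    then show ?thesis
      \<comment> \<open>Both polynomials are 1, which is the convention with
        \<open>b = 0\<close>.\<close>
      using const_strictly_interlaces_linear[of 1 0 1] T_poly_0 T_poly_1 by simp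
  next
    case (Suc m)
    then show ?thesis
      using T_poly_strictly_interlaces(1)[of m] by simp
  qed
  then show "real_rooted (T_poly n)"
    by (simp add: strictly_interlaces_def)
qed

end
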